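(* Let $(\mathbb{W}\subset A\times B,\|\cdot,\cdot\|)$ be a generalized two-normed space, let $k\in B$, and let $[\alpha,\beta]\subset\mathbb{R}$. If $g\in BV([\alpha,\beta],\mathbb{W}^k)$ and $\lambda\in[\alpha,\beta]$, then $$V_{\alpha}^{\lambda}(g,\mathbb{W}^k)+V_{\lambda}^{\beta}(g,\mathbb{W}^k)\le V_{\alpha}^{\beta}(g,\mathbb{W}^k).$$
   Context: Let $A,B$ be complex vector spaces and $\mathbb{W}\subset A\times B$ a non-empty set such that for all $x\in A$, $y\in B$ the sets $\mathbb{W}^{y}=\{u\in A:(u,y)\in\mathbb{W}\}$ and $\mathbb{W}_{x}=\{v\in B:(x,v)\in\mathbb{W}\}$ are vector subspaces of $A$ and $B$ respectively. A generalized two-norm on $\mathbb{W}$ is a map $\|\cdot,\cdot\|\colon\mathbb{W}\to[0,\infty)$ such that: (G1) $\|x,c y\|=|c|\|x,y\|=\|c x,y\|$ for all $c\in\mathbb{C}$, $(x,y)\in\mathbb{W}$; (G2) $\|x,y+z\|\le\|x,y\|+\|x,z\|$ whenever $(x,y),(x,z)\in\mathbb{W}$; (G3) $\|x+y,z\|\le\|x,z\|+\|y,z\|$ whenever $(x,z),(y,z)\in\mathbb{W}$. The pair $(\mathbb{W}\subset A\times B,\|\cdot,\cdot\|)$ is called a generalized two-normed space. For a closed interval $[c,d]\subset\mathbb{R}$, $\mathcal{P}([c,d])$ is the set of its finite partitions $P=\{c=t_0<t_1<\dots<t_n=d\}$. For $k\in B$ and a function $g$ with values in $\mathbb{W}^k$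 defined on (an interval containing) $[c,d]$ put $V_c^d[g,\mathbb{W}^k;P]=\sum_{i=1}^n\|g(t_i)-g(t_{i-1}),k\|$ for $P\in\mathcal{P}([c,d])$, and $V_c^d(g,\mathbb{W}^k)=\sup\{V_c^d[g,\mathbb{W}^k;P]:P\in\mathcal{P}([c,d])\}$; for a degenerate interval, $V_c^c(g,\mathbb{W}^k)=0$ (empty sum). $BV([c,d],\mathbb{W}^k)$ denotes the set of functions $g\colon[c,d]\to\mathbb{W}^k$ with $V_c^d(g,\mathbb{W}^k)<\infty$. *)

theory Defs
  imports "HOL-Analysis.Analysis"
begin

definition left_section :: "('a \<times> 'b) set \<Rightarrow> 'b \<Rightarrow> 'a set" where
  "left_section W y = {u. (u, y) \<in> W}"

definition right_section :: "('a \<times> 'b) set \<Rightarrow> 'a \<Rightarrow> 'b set" where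
  "right_section W x = {v. (x, v) \<in> W}"

(* The complex vector spaces A and B are the types 'a and 'b with scalar multiplications sA and sB.
   The two-norm N is a total function, but it is constrained only on W. *)
locale generalized_two_normed_space =
  A: vector_space sA + B: vector_space sB
  for sA :: "complex \<Rightarrow> 'a::ab_group_add \<Rightarrow> 'a"
    and sB :: "complex \<Rightarrow> 'b::ab_group_add \<Rightarrow> 'b" +
  fixes W :: "('a \<times> 'b) set"
    and N :: "'a \<Rightarrow> 'b \<Rightarrow> real"
  assumes W_nonempty: "W \<noteq> {}"
    and subspace_left_section: "\<And>y. A.subspace (left_section W y)"
    and subspace_right_section: "\<And>x. B.subspace (right_section W x)"
    and N_nonneg: "\<And>x y. (x, y) \<in> W \<Longrightarrow> 0 \<le> N x y"
    and N_scale_right: "\<And>c x y. (x, y) \<in> W \<Longrightarrow> N x (sB c y) = cmod c * N x y"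
    and N_scale_left: "\<And>c x y. (x, y) \<in> W \<Longrightarrow> N (sA c x) y = cmod c * N x y"
    and N_add_right: "\<And>x y z. (x, y) \<in> W \<Longrightarrow> (x, z) \<in> W \<Longrightarrow> N x (y + z) \<le> N x y + N x z"
    and N_add_left: "\<And>x y z. (x, z) \<in> W \<Longrightarrow> (y, z) \<in> W \<Longrightarrow> N (x + y) z \<le> N x z + N y z"

(* A partition c = t_0 < ... < t_n = d is the list [t_0, ..., t_n]; if c = d, the only one is [c]. *)
definition partitions :: "real \<Rightarrow> real \<Rightarrow> real list set" where
  "partitions c d = {P. P \<noteq> [] \<and> sorted_wrt (<) P \<and> hd P = c \<and> last P = d}"

definition variation_sum ::
  "('a::ab_group_add \<Rightarrow> 'b \<Rightarrow> real) \<Rightarrow> 'b \<Rightarrow> (real \<Rightarrow> 'a) \<Rightarrow> real list \<Rightarrow> real" where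
  "variation_sum N k g P = (\<Sum>i = 1..length P - 1. N (g (P ! i) - g (P ! (i - 1))) k)"

(* The supremum is taken in the extended reals, since it may be infinite. *)
definition variation ::
  "('a::ab_group_add \<Rightarrow> 'b \<Rightarrow> real) \<Rightarrow> 'b \<Rightarrow> (real \<Rightarrow> 'a) \<Rightarrow> real \<Rightarrow> real \<Rightarrow> ereal" where
  "variation N k g c d = (SUP P \<in> partitions c d. ereal (variation_sum N k g P))"

(* Functions on [c, d] are represented by total functions with arbitrary values outside [c, d];
   variation N k g c d does not depend on those values. *)
definition BV ::
  "('a::ab_group_add \<times> 'b) set \<Rightarrow> ('a \<Rightarrow> 'b \<Rightarrow> real) \<Rightarrow> 'b \<Rightarrow> real \<Rightarrow> real \<Rightarrow> (real \<Rightarrow> 'a) set" where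
  "BV W N k c d = {g \<in> {c..d} \<rightarrow> left_section W k. variation N k g c d < \<infinity>}"

lemma partitions_degenerate: "partitions c c = {[c]}"
proof
  show "partitions c c \<subseteq> {[c]}"
  proof
    fix P assume P: "P \<in> partitions c c"
    show "P \<in> {[c]}"
    proof (cases P)
      case Nil
      then show ?thesis using P by (simp add: partitions_def)
    next
      case (Cons x xs)
      have "xs = []"
      proof (rule ccontr)
        assume "xs \<noteq> []"
        then have "last xs \<in> set xs" by simp
        then show False
          using P Cons \<open>xs \<noteq> []\<close> by (auto simp: partitions_def)
      qed
      then show ?thesis using P Cons by (simp add: partitions_def)
    qed
  qed
qed (simp add: partitions_def)

lemma variation_degenerate: "variation N k g c c = 0"
  by (simp add: variation_def partitions_degenerate variation_sum_def zero_ereal_def)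

end

theory Submission
  imports Defs
begin

text \<open>A partition of the left interval and one of the right interval glue at their common
  endpoint into a partition of the whole, and the variation sums add
  (\<open>partitions_append\<close>). So every sum of a left and a right variation sum is bounded by
  the total variation. Taking suprema over the two partitions independently gives
  \<open>variation_superadditive\<close>, an inequality in the extended reals.\<close>

lemma variation_sum_singleton [simp]: "variation_sum N k g [x] = 0"
  by (simp add: variation_sum_def)

text \<open>Splitting off the first increment turns the indexed sum into a recursion on the list, so
  that later proofs can use list induction. The two reindexings pass between indices starting at 1
  and at 0.\<close>

lemma variation_sum_Cons_Cons [simp]:
  "variation_sum N k g (x # y # zs) = N (g y - g x) k + variation_sum N k g (y # zs)"
proof -
  have "variation_sum N k g (x # y # zs)
      = (\<Sum>i<Suc (length zs). N (g ((x # y # zs) ! Suc i) - g ((x # y # zs) ! i)) k)"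
    unfolding variation_sum_def
    by (rule sum.reindex_bij_witness[of _ Suc "\<lambda>i. i - 1"]) auto
  also have "\<dots> = N (g y - g x) k + (\<Sum>i<length zs. N (g ((y # zs) ! Suc i) - g ((y # zs) ! i)) k)"
    by (subst sum.lessThan_Suc_shift) simp
  also have "(\<Sum>i<length zs. N (g ((y # zs) ! Suc i) - g ((y # zs) ! i)) k)
      = variation_sum N k g (y # zs)"
    unfolding variation_sum_def
    by (rule sum.reindex_bij_witness[of _ "\<lambda>i. i - 1" Suc]) auto
  finally show ?thesis .
qed

text \<open>The cut node \<open>z\<close> is kept in both pieces, so each increment is counted in
  exactly one of them.\<close>

lemma variation_sum_append:
  "variation_sum N k g (xs @ z # ys) = variation_sum N k g (xs @ [z]) + variation_sum N k g (z # ys)"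
proof (induction xs)
  case (Cons x xs)
  then show ?case by (cases xs) auto
qed simp

text \<open>Needed because a constant can be moved out of a supremum in \<open>ereal\<close> only
  over a nonempty index set; over the empty set the supremum is -\<infinity>.\<close>

lemma partitions_nonempty:
  assumes "c \<le> d"
  shows "partitions c d \<noteq> {}"
proof (cases "c = d")
  case False
  then have "[c, d] \<in> partitions c d"
    using assms by (simp add: partitions_def)
  then show ?thesis by blast
qed (simp add: partitions_degenerate)

text \<open>Both lists contain the common endpoint \<open>d\<close>; \<open>tl\<close> drops the
  second copy, which keeps the glued list strictly increasing. This also covers degenerate
  intervals, where \<open>P\<close> or \<open>Q\<close> is \<open>[d]\<close>.\<close>

lemma partitions_append:
  assumes "P \<in> partitions c d" and "Q \<in> partitions d e"
  shows "P @ tl Q \<in> partitions c e"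
    and "variation_sum N k g (P @ tl Q) = variation_sum N k g P + variation_sum N k g Q"
proof -
  obtain xs where P: "P = xs @ [d]"
    using assms(1) append_butlast_last_id[of P, symmetric] unfolding partitions_def by auto
  obtain ys where Q: "Q = d # ys"
    using assms(2) unfolding partitions_def by (cases Q) auto
  show "P @ tl Q \<in> partitions c e"
    using assms unfolding P Q partitions_def
    by (fastforce simp: sorted_wrt_append hd_append)
  show "variation_sum N k g (P @ tl Q) = variation_sum N k g P + variation_sum N k g Q"
    unfolding P Q using variation_sum_append[of N k g xs d ys] by simp
qed

lemma variation_superadditive:
  assumes "c \<le> d" and "d \<le> e"
  shows "variation N k g c d + variation N k g d e \<le> variation N k g c e"
proof -
  let ?s = "\<lambda>P. ereal (variation_sum N k g P)"
  obtain Q0 where "Q0 \<in> partitions d e"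
    using partitions_nonempty[OF assms(2)] by blast
  then have "?s Q0 \<le> variation N k g d e"
    unfolding variation_def by (rule SUP_upper)
  \<comment> \<open>A real lower bound excludes -\<infinity>, the one value that may not be moved
    out of the supremum over \<open>P\<close> below; the value \<infinity> does no harm.\<close>
  then have fin: "variation N k g d e \<noteq> -\<infinity>" by auto
  have "?s P + variation N k g d e \<le> variation N k g c e" if P: "P \<in> partitions c d" for P
  proof -
    \<comment> \<open>With \<open>P\<close> fixed, \<open>?s P\<close> is a real constant and moves
      inside the supremum over \<open>Q\<close>.\<close>
    have "?s P + variation N k g d e = (SUP Q \<in> partitions d e. ?s P + ?s Q)"
      unfolding variation_def
      by (rule SUP_ereal_add_right[symmetric]) (use partitions_nonempty[OF assms(2)] in auto)
    also have "\<dots> \<le> variation N k g c e"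
    proof (rule SUP_least)
      fix Q assume Q: "Q \<in> partitions d e"
      have "?s P + ?s Q = ?s (P @ tl Q)"
        by (simp add: partitions_append(2)[OF P Q])
      also have "\<dots> \<le> variation N k g c e"
        unfolding variation_def by (rule SUP_upper) (rule partitions_append(1)[OF P Q])
      finally show "?s P + ?s Q \<le> variation N k g c e" .
    qed
    finally show ?thesis .
  qed
  \<comment> \<open>The bound is uniform in \<open>P\<close>, so the supremum over \<open>P\<close>
    can now be taken as well.\<close>
  then have "(SUP P \<in> partitions c d. ?s P + variation N k g d e) \<le> variation N k g c e"
    by (rule SUP_least)
  then show ?thesis
    using SUP_ereal_add_left[OF partitions_nonempty[OF assms(1)] fin, of ?s]
    by (simp add: variation_def)
qed

theorem theorem4p13:
  fixes sA :: "complex \<Rightarrow> 'a::ab_group_add \<Rightarrow> 'a"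
    and sB :: "complex \<Rightarrow> 'b::ab_group_add \<Rightarrow> 'b"
    and W :: "('a \<times> 'b) set"
    and N :: "'a \<Rightarrow> 'b \<Rightarrow> real"
    and k :: 'b
    and g :: "real \<Rightarrow> 'a"
    and \<alpha> \<beta> l :: real
  assumes "generalized_two_normed_space sA sB W N"
    and "g \<in> BV W N k \<alpha> \<beta>"
    and "l \<in> {\<alpha>..\<beta>}"
  shows "variation N k g \<alpha> l + variation N k g l \<beta> \<le> variation N k g \<alpha> \<beta>"
  using assms(3) by (auto intro: variation_superadditive)

end
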